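(* Let $L=DWD^\top\in\mathbb{R}^{n\times n}$ be the signed Laplacian of a signed graph with $n$ nodes, partitioned according to a partition of the nodes into $n_B$ boundary nodes and $n_C$ central nodes ($n_B+n_C=n$) as $$L=\begin{bmatrix} L_{BB} & L_{BC}\\ L_{CB} & L_{CC}\end{bmatrix},\qquad L_{BB}\in\mathbb{R}^{n_B\times n_B},\quad L_{CC}\in\mathbb{R}^{n_C\times n_C}.$$ Assume that $L_{CC}$ is nonsingular. Then $L$ and its Kron reduction $\widehat L=L/L_{CC}=L_{BB}-L_{BC}L_{CC}^{-1}L_{CB}$ satisfy $$\operatorname{corank} L=\operatorname{corank}\widehat L .$$
   Context: A signed graph with $n$ nodes and $m$ edges is defined by an incidence matrix $D\in\mathbb{R}^{n\times m}$ (the column of an edge between nodes $i$ and $k$ has one entry $1$ and one entry $-1$ at positions $i,k$, all other entries $0$) and a diagonal signed weight matrix $W=\mathrm{diag}(w_1,\dots,w_m)\in\mathbb{R}^{m\times m}$, where the $w_j$ may be positive or negative. Its signed Laplacian is $L=DWD^\top$. For a square matrix $M$, $\operatorname{corank} M=\dim\ker M$. The Schur complement $\widehat L=L/L_{CC}$ is called the (signed) Kron reduction of $L$. *)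

theory Defs
  imports
    "Jordan_Normal_Form.Matrix_Kernel"
    "Jordan_Normal_Form.Gauss_Jordan_Elimination"
    "Jordan_Normal_Form.DL_Submatrix"
begin

definition incidence_matrix :: "nat \<Rightarrow> nat \<Rightarrow> real mat \<Rightarrow> bool" where
  "incidence_matrix n m D \<longleftrightarrow>
     D \<in> carrier_mat n m \<and>
     (\<forall>j<m. \<exists>i<n. \<exists>k<n. i \<noteq> k \<and> D $$ (i, j) = 1 \<and> D $$ (k, j) = -1 \<and>
        (\<forall>l<n. l \<noteq> i \<longrightarrow> l \<noteq> k \<longrightarrow> D $$ (l, j) = 0))"

(* No sign condition on the weights, and parallel edges are allowed. *)
definition signed_graph :: "nat \<Rightarrow> nat \<Rightarrow> real mat \<Rightarrow> real mat \<Rightarrow> bool" where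
  "signed_graph n m D W \<longleftrightarrow>
     incidence_matrix n m D \<and> W \<in> carrier_mat m m \<and> diagonal_mat W"

definition signed_laplacian :: "real mat \<Rightarrow> real mat \<Rightarrow> real mat" where
  "signed_laplacian D W = D * W * transpose_mat D"

(* Each block submatrix L I J lists the indices in I and in J in increasing order.
   The value is meaningful only if the block L_CC is invertible: otherwise
   mat_inverse returns None. *)
definition kron_reduction :: "real mat \<Rightarrow> nat set \<Rightarrow> nat set \<Rightarrow> real mat" where
  "kron_reduction L B C =
     submatrix L B B - submatrix L B C * the (mat_inverse (submatrix L C C)) * submatrix L C B"

definition corank :: "real mat \<Rightarrow> nat" where
  "corank M = kernel_dim M"

end

(* Eliminating the central coordinates from L x = 0 by x_C = - L_CC^-1 L_CB x_B leaves exactly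
   the equation for x_B given by the Schur complement, so restriction to the boundary coordinates
   is a linear bijection between the two kernels. *)
theory Submission
  imports Defs
begin

section \<open>Kernel dimensions and matrix inverses\<close>

lemma kernel_dim_eq_bij_betw:
  fixes A A' :: "'a :: field mat"
  assumes bij: "bij_betw T (mat_kernel A) (mat_kernel A')"
    and add: "\<And>u v. u \<in> mat_kernel A \<Longrightarrow> v \<in> mat_kernel A \<Longrightarrow> T (u + v) = T u + T v"
    and smult: "\<And>a v. v \<in> mat_kernel A \<Longrightarrow> T (a \<cdot>\<^sub>v v) = a \<cdot>\<^sub>v T v"
  shows "kernel_dim A = kernel_dim A'"
proof -
  interpret K: kernel "dim_row A" "dim_col A" A by unfold_locales auto
  interpret K': kernel "dim_row A'" "dim_col A'" A' by unfold_locales auto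
  \<comment> \<open>\<open>T\<close> is additive and homogeneous on the kernel of \<open>A\<close>,
    and that kernel is the whole carrier of \<open>K.VK\<close>. So \<open>T\<close> is a linear map
    between the two kernels viewed as vector spaces.\<close>
  have "T \<in> LinearCombinations.module_hom class_ring K.VK K'.VK"
    using bij_betwE[OF bij] add smult by (auto simp: LinearCombinations.module_hom_def module_vec_simps)
  then interpret linear_map class_ring K.VK K'.VK T
    by (intro linear_map.intro mod_hom.intro mod_hom_axioms.intro) unfold_locales
  \<comment> \<open>\<open>dim_eq\<close> compares dimensions only when the source is
    finite-dimensional; a finite basis of the kernel provides this.\<close>
  obtain S where "finite S" "K.basis S"
    using kernel_basis_exists[OF K.A] by blast
  then have "K.Ker.fin_dim"
    unfolding K.Ker.fin_dim_def K.Ker.basis_def by auto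
  moreover have "inj_on T (carrier K.VK)" "T ` carrier K.VK = carrier K'.VK"
    using bij by (simp_all add: bij_betw_def)
  ultimately have "K.dim = K'.dim" by (rule dim_eq)
  then show ?thesis by simp
qed

lemma the_mat_inverse:
  fixes A :: "'a :: field mat"
  assumes A: "A \<in> carrier_mat n n" and inv: "invertible_mat A"
  shows "A * the (mat_inverse A) = 1\<^sub>m n" "the (mat_inverse A) * A = 1\<^sub>m n"
    "the (mat_inverse A) \<in> carrier_mat n n"
proof -
  obtain K where AK: "A * K = 1\<^sub>m n" and KA: "K * A = 1\<^sub>m (dim_row K)"
    using inv A by (auto simp: invertible_mat_def inverts_mat_def)
  \<comment> \<open>\<open>invertible_mat\<close> leaves the shape of the inverse open. Comparing
    column counts in both products forces it to be square of size \<open>n\<close>.\<close>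
  have "dim_row K = n" "dim_col K = n"
    using arg_cong[OF AK, of dim_col] arg_cong[OF KA, of dim_col] A by auto
  then have "A \<in> Units (ring_mat TYPE('a) n ())"
    using A AK KA unfolding Units_def by (auto simp: ring_mat_def intro!: bexI[of _ K])
  \<comment> \<open>A result \<open>None\<close> would place \<open>A\<close> outside the units of
    the matrix ring.\<close>
  then obtain M where "mat_inverse A = Some M"
    using mat_inverse(1)[OF A, where b = "()"] by (cases "mat_inverse A") auto
  with mat_inverse(2)[OF A]
  show "A * the (mat_inverse A) = 1\<^sub>m n" "the (mat_inverse A) * A = 1\<^sub>m n"
    "the (mat_inverse A) \<in> carrier_mat n n" by auto
qed

section \<open>Restricting vectors and matrices to index sets\<close>

lemma bij_betw_pick:
  assumes "finite I"
  shows "bij_betw (pick I) {0..<card I} I"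
\<comment> \<open>The inverse of \<open>pick I\<close> is the rank: the number of smaller elements
  of \<open>I\<close>, counted from 0.\<close>
proof (rule bij_betw_byWitness[where f' = "\<lambda>i. card {a \<in> I. a < i}"])
  show "(\<lambda>i. card {a \<in> I. a < i}) ` I \<subseteq> {0..<card I}"
    using assms by (auto intro!: psubset_card_mono)
qed (auto simp: card_pick pick_card_in_set pick_in_set)

text \<open>Indexing by \<open>pick\<close> lists the entries in the same increasing order as
  \<open>submatrix\<close> lists rows and columns, so that block products line up.\<close>

definition subvector :: "'a vec \<Rightarrow> nat set \<Rightarrow> 'a vec" where
  "subvector v I = vec (card I) (\<lambda>i. v $ pick I i)"

lemma subvector_carrier [simp]: "subvector v I \<in> carrier_vec (card I)"
  by (simp add: subvector_def)

lemma subvector_add: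
  assumes "u \<in> carrier_vec n" "v \<in> carrier_vec n" "I \<subseteq> {0..<n}"
  shows "subvector (u + v) I = subvector u I + subvector v I"
proof (rule eq_vecI)
  fix i assume "i < dim_vec (subvector u I + subvector v I)"
  then have "i < card I" by (simp add: subvector_def)
  then show "subvector (u + v) I $ i = (subvector u I + subvector v I) $ i"
    using assms pick_in_set[of i I] by (auto simp: subvector_def)
qed (simp add: subvector_def)

lemma subvector_smult:
  assumes "v \<in> carrier_vec n" "I \<subseteq> {0..<n}"
  shows "subvector (a \<cdot>\<^sub>v v) I = a \<cdot>\<^sub>v subvector v I"
proof (rule eq_vecI)
  fix i assume "i < dim_vec (a \<cdot>\<^sub>v subvector v I)"
  then have "i < card I" by (simp add: subvector_def)
  then show "subvector (a \<cdot>\<^sub>v v) I $ i = (a \<cdot>\<^sub>v subvector v I) $ i"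
    using assms pick_in_set[of i I] by (auto simp: subvector_def)
qed (simp add: subvector_def)

lemma subvector_zero:
  assumes "I \<subseteq> {0..<n}"
  shows "subvector (0\<^sub>v n) I = 0\<^sub>v (card I)"
proof (rule eq_vecI)
  fix i assume "i < dim_vec (0\<^sub>v (card I) :: 'a vec)"
  then have "i < card I" by simp
  then show "subvector (0\<^sub>v n) I $ i = (0\<^sub>v (card I) :: 'a vec) $ i"
    using assms pick_in_set[of i I] by (auto simp: subvector_def)
qed (simp add: subvector_def)

lemma subvector_index_card:
  assumes "finite I" "i \<in> I"
  shows "subvector v I $ card {a \<in> I. a < i} = v $ i"
proof -
  \<comment> \<open>The elements below \<open>i\<close> form a proper subset of \<open>I\<close>, as
    \<open>i\<close> is missing, so the rank is a valid position.\<close>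
  have "card {a \<in> I. a < i} < card I"
    using assms by (auto intro!: psubset_card_mono)
  with assms(2) show ?thesis by (simp add: subvector_def pick_card_in_set)
qed

text \<open>Each coordinate lies in one of the two sets and can be read back at its rank there. This
  serves twice: to split \<open>A *\<^sub>v v = 0\<^sub>v n\<close> into block rows, and for
  injectivity of the restriction.\<close>

lemma eq_vec_if_subvectors_eq:
  assumes "u \<in> carrier_vec n" "v \<in> carrier_vec n" "B \<union> C = {0..<n}"
    and "subvector u B = subvector v B" "subvector u C = subvector v C"
  shows "u = v"
proof (rule eq_vecI)
  have fin: "finite B" "finite C"
    using assms(3) by (metis finite_Un finite_atLeastLessThan)+
  fix i assume "i < dim_vec v"
  then have "i \<in> B \<or> i \<in> C" using assms(2,3) by auto
  then show "u $ i = v $ i"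
    using fin assms(4,5) by (metis subvector_index_card)
qed (use assms in auto)

text \<open>Gluing two blocks is the source of surjectivity: a boundary vector can be extended by
  any chosen central part.\<close>

lemma ex_vec_subvectors:
  assumes un: "B \<union> C = {0..<n}" and dis: "B \<inter> C = {}"
    and b: "b \<in> carrier_vec (card B)" and c: "c \<in> carrier_vec (card C)"
  obtains v where "v \<in> carrier_vec n" "subvector v B = b" "subvector v C = c"
proof
  let ?v = "vec n (\<lambda>i. if i \<in> B then b $ card {a \<in> B. a < i} else c $ card {a \<in> C. a < i})"
  show "?v \<in> carrier_vec n" by simp
  show "subvector ?v B = b"
  proof (rule eq_vecI)
    fix i assume "i < dim_vec b"
    with b have i: "i < card B" by simp
    then have "pick B i \<in> B" "pick B i < n" using un pick_in_set[of i B] by auto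
    then show "subvector ?v B $ i = b $ i" using i by (simp add: subvector_def card_pick)
  qed (use b in \<open>simp add: subvector_def\<close>)
  show "subvector ?v C = c"
  proof (rule eq_vecI)
    fix i assume "i < dim_vec c"
    with c have i: "i < card C" by simp
    \<comment> \<open>Disjointness sends the positions of \<open>C\<close> to the second branch of
      the conditional.\<close>
    then have "pick C i \<notin> B" "pick C i < n" using un dis pick_in_set[of i C] by auto
    then show "subvector ?v C $ i = c $ i" using i by (simp add: subvector_def card_pick)
  qed (use c in \<open>simp add: subvector_def\<close>)
qed

lemma submatrix_carrier:
  assumes "A \<in> carrier_mat nr nc" "I \<subseteq> {0..<nr}" "J \<subseteq> {0..<nc}"
  shows "submatrix A I J \<in> carrier_mat (card I) (card J)"
proof -
  have "{i. i < nr \<and> i \<in> I} = I" "{j. j < nc \<and> j \<in> J} = J" using assms(2,3) by auto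
  with assms(1) show ?thesis by (auto simp: dim_submatrix)
qed

text \<open>Reindexing along \<open>pick J\<close> replaces positions by the indices themselves, so
  that sums over disjoint column sets can be merged.\<close>

lemma submatrix_mult_subvector_index:
  fixes A :: "'a :: comm_semiring_0 mat"
  assumes A: "A \<in> carrier_mat nr nc" and I: "I \<subseteq> {0..<nr}" and J: "J \<subseteq> {0..<nc}"
    and i: "i < card I"
  shows "(submatrix A I J *\<^sub>v subvector v J) $ i = (\<Sum>j\<in>J. A $$ (pick I i, j) * v $ j)"
proof -
  have IJ: "{i. i < nr \<and> i \<in> I} = I" "{j. j < nc \<and> j \<in> J} = J" using I J by auto
  have "finite J" using J finite_subset by blast
  have "(submatrix A I J *\<^sub>v subvector v J) $ i
      = (\<Sum>j = 0..<card J. A $$ (pick I i, pick J j) * v $ pick J j)"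
    using submatrix_carrier[OF A I J] i A IJ
    by (auto simp: scalar_prod_def subvector_def submatrix_index intro!: sum.cong)
  also have "\<dots> = (\<Sum>j\<in>J. A $$ (pick I i, j) * v $ j)"
    by (rule sum.reindex_bij_betw[OF bij_betw_pick[OF \<open>finite J\<close>]])
  finally show ?thesis .
qed

lemma subvector_mult_mat_vec:
  fixes A :: "'a :: comm_semiring_0 mat"
  assumes A: "A \<in> carrier_mat nr nc" and v: "v \<in> carrier_vec nc" and I: "I \<subseteq> {0..<nr}"
    and un: "B \<union> C = {0..<nc}" and dis: "B \<inter> C = {}"
  shows "subvector (A *\<^sub>v v) I
    = submatrix A I B *\<^sub>v subvector v B + submatrix A I C *\<^sub>v subvector v C"
proof (rule eq_vecI)
  have sub: "B \<subseteq> {0..<nc}" "C \<subseteq> {0..<nc}" using un by auto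
  note cB = submatrix_carrier[OF A I sub(1)] and cC = submatrix_carrier[OF A I sub(2)]
  show "dim_vec (subvector (A *\<^sub>v v) I)
      = dim_vec (submatrix A I B *\<^sub>v subvector v B + submatrix A I C *\<^sub>v subvector v C)"
    using cC by (simp add: subvector_def)
  fix i
  assume "i < dim_vec (submatrix A I B *\<^sub>v subvector v B + submatrix A I C *\<^sub>v subvector v C)"
  then have i: "i < card I" using cC by simp
  then have "pick I i < nr" using I pick_in_set[of i I] by auto
  then have "subvector (A *\<^sub>v v) I $ i = (\<Sum>j\<in>B \<union> C. A $$ (pick I i, j) * v $ j)"
    using A v i un by (simp add: subvector_def scalar_prod_def)
  also have "\<dots> = (\<Sum>j\<in>B. A $$ (pick I i, j) * v $ j) + (\<Sum>j\<in>C. A $$ (pick I i, j) * v $ j)"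
    using dis sub by (intro sum.union_disjoint) (auto intro: finite_subset)
  also have "\<dots> = (submatrix A I B *\<^sub>v subvector v B + submatrix A I C *\<^sub>v subvector v C) $ i"
    using i cC submatrix_mult_subvector_index[OF A I sub(1) i, of v]
      submatrix_mult_subvector_index[OF A I sub(2) i, of v]
    by (simp del: index_mult_mat_vec)
  finally show "subvector (A *\<^sub>v v) I $ i
    = (submatrix A I B *\<^sub>v subvector v B + submatrix A I C *\<^sub>v subvector v C) $ i" .
qed

section \<open>Block elimination and the Schur complement\<close>

text \<open>The second block row determines \<open>c\<close> uniquely, and substitution into the
  first leaves the Schur complement. The equivalence, for given \<open>b\<close> and
  \<open>c\<close>, serves both injectivity and surjectivity later.\<close>

lemma block_elimination:
  fixes P Q R S K :: "'a :: comm_ring_1 mat"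
  assumes P: "P \<in> carrier_mat p p" and Q: "Q \<in> carrier_mat p q"
    and R: "R \<in> carrier_mat q p" and S: "S \<in> carrier_mat q q"
    and K: "K \<in> carrier_mat q q" and SK: "S * K = 1\<^sub>m q" and KS: "K * S = 1\<^sub>m q"
    and b: "b \<in> carrier_vec p" and c: "c \<in> carrier_vec q"
  shows "P *\<^sub>v b + Q *\<^sub>v c = 0\<^sub>v p \<and> R *\<^sub>v b + S *\<^sub>v c = 0\<^sub>v q \<longleftrightarrow>
    (P - Q * K * R) *\<^sub>v b = 0\<^sub>v p \<and> c = - (K *\<^sub>v (R *\<^sub>v b))"
proof -
  have Rb: "R *\<^sub>v b \<in> carrier_vec q" and Sc: "S *\<^sub>v c \<in> carrier_vec q"
    and KRb: "K *\<^sub>v (R *\<^sub>v b) \<in> carrier_vec q" using R S K b c by auto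
  have "R *\<^sub>v b + S *\<^sub>v c = 0\<^sub>v q \<longleftrightarrow> c = - (K *\<^sub>v (R *\<^sub>v b))"
  proof
    assume "R *\<^sub>v b + S *\<^sub>v c = 0\<^sub>v q"
    \<comment> \<open>Solving for \<open>c\<close> uses the left inverse \<open>KS\<close>.\<close>
    then have "K *\<^sub>v (R *\<^sub>v b + S *\<^sub>v c) = 0\<^sub>v q" using K by auto
    then have "K *\<^sub>v (R *\<^sub>v b) + K *\<^sub>v (S *\<^sub>v c) = 0\<^sub>v q"
      using mult_add_distrib_mat_vec[OF K Rb Sc] by simp
    moreover have "K *\<^sub>v (S *\<^sub>v c) = c"
      using assoc_mult_mat_vec[OF K S c] KS c by simp
    ultimately have *: "K *\<^sub>v (R *\<^sub>v b) + c = 0\<^sub>v q" by simp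
    show "c = - (K *\<^sub>v (R *\<^sub>v b))"
    proof (rule eq_vecI)
      fix i assume "i < dim_vec (- (K *\<^sub>v (R *\<^sub>v b)))"
      then show "c $ i = (- (K *\<^sub>v (R *\<^sub>v b))) $ i"
        using arg_cong[OF *, of "\<lambda>w. w $ i"] K c
        by (auto simp: eq_neg_iff_add_eq_0 add.commute)
    qed (use K c in auto)
  next
    assume "c = - (K *\<^sub>v (R *\<^sub>v b))"
    \<comment> \<open>Checking that this \<open>c\<close> solves the second row uses the right
      inverse \<open>SK\<close>.\<close>
    then have "S *\<^sub>v c = - (S *\<^sub>v (K *\<^sub>v (R *\<^sub>v b)))"
      using S K R b by (auto simp: scalar_prod_def sum_negf intro!: eq_vecI)
    also have "S *\<^sub>v (K *\<^sub>v (R *\<^sub>v b)) = R *\<^sub>v b"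
      using assoc_mult_mat_vec[OF S K Rb] SK Rb by simp
    finally show "R *\<^sub>v b + S *\<^sub>v c = 0\<^sub>v q" using Rb by auto
  qed
  \<comment> \<open>The solved form of \<open>c\<close> may be assumed here: either side of the
    claimed equivalence supplies it.\<close>
  moreover have "P *\<^sub>v b + Q *\<^sub>v c = (P - Q * K * R) *\<^sub>v b" if "c = - (K *\<^sub>v (R *\<^sub>v b))"
  proof -
    have "Q *\<^sub>v c = - (Q *\<^sub>v (K *\<^sub>v (R *\<^sub>v b)))"
      using that Q K by (auto simp: scalar_prod_def sum_negf intro!: eq_vecI)
    also have "Q *\<^sub>v (K *\<^sub>v (R *\<^sub>v b)) = (Q * K * R) *\<^sub>v b"
      unfolding assoc_mult_mat_vec[OF mult_carrier_mat[OF Q K] R b]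
        assoc_mult_mat_vec[OF Q K Rb] ..
    finally show ?thesis
      using P Q K R b
      by (simp add: minus_mult_distrib_mat_vec[of _ p p]) (auto intro!: eq_vecI)
  qed
  ultimately show ?thesis by auto
qed

theorem kernel_dim_schur_complement:
  fixes A :: "'a :: field mat"
  assumes A: "A \<in> carrier_mat n n" and un: "B \<union> C = {0..<n}" and dis: "B \<inter> C = {}"
    and K: "K \<in> carrier_mat (card C) (card C)"
    and SK: "submatrix A C C * K = 1\<^sub>m (card C)" and KS: "K * submatrix A C C = 1\<^sub>m (card C)"
  shows "kernel_dim A
    = kernel_dim (submatrix A B B - submatrix A B C * K * submatrix A C B)"
    (is "_ = kernel_dim ?M")
proof -
  have sub: "B \<subseteq> {0..<n}" "C \<subseteq> {0..<n}" using un by auto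
  note car = submatrix_carrier[OF A sub(1) sub(1)] submatrix_carrier[OF A sub(1) sub(2)]
    submatrix_carrier[OF A sub(2) sub(1)] submatrix_carrier[OF A sub(2) sub(2)]
  have M: "?M \<in> carrier_mat (card B) (card B)" using car K by auto
  \<comment> \<open>The only possible central part of a kernel vector with boundary part
    \<open>b\<close>.\<close>
  define c where "c b = - (K *\<^sub>v (submatrix A C B *\<^sub>v b))" for b
  \<comment> \<open>In block coordinates the kernel of \<open>A\<close> is the graph of
    \<open>c\<close> over the kernel of \<open>?M\<close>.\<close>
  have ker: "v \<in> mat_kernel A \<longleftrightarrow>
      subvector v B \<in> mat_kernel ?M \<and> subvector v C = c (subvector v B)"
    if v: "v \<in> carrier_vec n" for v
  proof -
    have Av: "A *\<^sub>v v \<in> carrier_vec n" using A v by auto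
    have "v \<in> mat_kernel A \<longleftrightarrow> A *\<^sub>v v = 0\<^sub>v n"
      using v by (simp add: mat_kernel[OF A])
    also have "\<dots> \<longleftrightarrow> subvector (A *\<^sub>v v) B = 0\<^sub>v (card B) \<and> subvector (A *\<^sub>v v) C = 0\<^sub>v (card C)"
      using eq_vec_if_subvectors_eq[OF Av _ un, of "0\<^sub>v n"] subvector_zero[OF sub(1)]
        subvector_zero[OF sub(2)] by auto
    also have "\<dots> \<longleftrightarrow> ?M *\<^sub>v subvector v B = 0\<^sub>v (card B) \<and> subvector v C = c (subvector v B)"
      unfolding subvector_mult_mat_vec[OF A v sub(1) un dis]
        subvector_mult_mat_vec[OF A v sub(2) un dis] c_def
      by (rule block_elimination[OF car K SK KS]) simp_all
    finally show ?thesis by (simp add: mat_kernel[OF M])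
  qed
  have n: "v \<in> carrier_vec n" if "v \<in> mat_kernel A" for v
    using that mat_kernel_carrier[OF A] by auto
  have "bij_betw (\<lambda>v. subvector v B) (mat_kernel A) (mat_kernel ?M)"
  proof (rule bij_betw_imageI)
    show "inj_on (\<lambda>v. subvector v B) (mat_kernel A)"
    proof (rule inj_onI)
      fix u v assume *: "u \<in> mat_kernel A" "v \<in> mat_kernel A" "subvector u B = subvector v B"
      \<comment> \<open>The central parts agree too, being the value of \<open>c\<close> at the same
        boundary part.\<close>
      then show "u = v"
        using eq_vec_if_subvectors_eq[OF n n un] ker[OF n] by metis
    qed
    have "b \<in> (\<lambda>v. subvector v B) ` mat_kernel A" if b: "b \<in> mat_kernel ?M" for b
    proof -
      have "b \<in> carrier_vec (card B)" using b mat_kernel_carrier[OF M] by auto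
      moreover have "c b \<in> carrier_vec (card C)" using K by (intro carrier_vecI) (simp add: c_def)
      \<comment> \<open>The vector glued from \<open>b\<close> and \<open>c b\<close> lies in the
        kernel of \<open>A\<close> by \<open>ker\<close>, and it restricts to
        \<open>b\<close>.\<close>
      ultimately obtain v where "v \<in> carrier_vec n" "subvector v B = b" "subvector v C = c b"
        using ex_vec_subvectors[OF un dis] by blast
      with b ker show ?thesis by auto
    qed
    then show "(\<lambda>v. subvector v B) ` mat_kernel A = mat_kernel ?M"
      using ker n by auto
  qed
  then show ?thesis
    by (rule kernel_dim_eq_bij_betw)
      (blast intro: subvector_add[OF n n sub(1)] subvector_smult[OF n sub(1)])+
qed

section \<open>The Kron reduction of a signed Laplacian\<close>

theorem lemma1:
  fixes n m nB nC :: nat and D W L :: "real mat" and B C :: "nat set"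
  assumes "signed_graph n m D W"
    and "L = signed_laplacian D W"
    and "B \<union> C = {0..<n}" and "B \<inter> C = {}"
    and "card B = nB" and "card C = nC"
    and "invertible_mat (submatrix L C C)"
  shows "corank L = corank (kron_reduction L B C)"
proof -
  have L: "L \<in> carrier_mat n n"
    using assms(1,2) by (auto simp: signed_graph_def incidence_matrix_def signed_laplacian_def)
  have "C \<subseteq> {0..<n}" using assms(3) by auto
  \<comment> \<open>Invertibility of the central block makes the
    \<open>the (mat_inverse ...)\<close> inside \<open>kron_reduction\<close> its actual two-sided
    inverse.\<close>
  note inv = the_mat_inverse[OF submatrix_carrier[OF L this this] assms(7)]
  show ?thesis
    unfolding corank_def kron_reduction_def
    by (rule kernel_dim_schur_complement[OF L assms(3,4) inv(3,1,2)])
qed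

end
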